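(* For all positive integers $1\le r<s\le t$ we have $D_{r,t}(n)\ge D_{s,t}(n)$ for all sufficiently large $n$. In particular, if $2\le t\le 10$, then for all $1\le r<s\le t$ the inequality $D_{r,t}(n)\ge D_{s,t}(n)$ holds for all $n>8$.
   Context: For integers $0<r\le t$ and $n\ge 0$, $D_{r,t}(n)$ is the total number of parts congruent to $r$ modulo $t$ among all partitions of $n$ into distinct parts (partitions no two of whose parts are equal): $D_{r,t}(n)=\sum_{\lambda}\#\{\lambda_i\in\lambda:\lambda_i\equiv r \pmod t\}$, the sum being over partitions $\lambda$ of $n$ into distinct parts. *)

theory Defs
  imports Complex_Main "HOL-Library.Multiset" "HOL-Number_Theory.Cong"
begin

definition is_partition :: "nat \<Rightarrow> nat multiset \<Rightarrow> bool" where
  "is_partition n p \<longleftrightarrow> (\<forall>k\<in>#p. 0 < k) \<and> \<Sum>\<^sub># p = n"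

definition distinct_partitions :: "nat \<Rightarrow> nat multiset set" where
  "distinct_partitions n = {p. is_partition n p \<and> (\<forall>k. count p k \<le> 1)}"

definition D :: "nat \<Rightarrow> nat \<Rightarrow> nat \<Rightarrow> nat" where
  "D r t n = (\<Sum>p\<in>distinct_partitions n. size {#k \<in># p. [k = r] (mod t)#})"

(* The sum defining D ranges over a finite set, so it never takes the default value 0
   that sum assigns to infinite index sets. *)
lemma finite_distinct_partitions: "finite (distinct_partitions n)"
proof -
  have size_le: "size p \<le> \<Sum>\<^sub># p" if "\<forall>k\<in>#p. 0 < k" for p :: "nat multiset"
    using that by (induction p) auto
  have part_le: "k \<le> \<Sum>\<^sub># p" if "k \<in># p" for k and p :: "nat multiset"
    using that by (auto dest!: multi_member_split)
  have "p \<in> mset ` {xs. set xs \<subseteq> {..n} \<and> length xs \<le> n}"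
    if p: "p \<in> distinct_partitions n" for p
  proof -
    obtain xs where xs: "mset xs = p"
      using ex_mset by blast
    have "\<forall>k\<in>#p. 0 < k" "\<Sum>\<^sub># p = n"
      using p by (auto simp: distinct_partitions_def is_partition_def)
    then have "size p \<le> n" "\<forall>k\<in>#p. k \<le> n"
      using size_le part_le by blast+
    then have "set xs \<subseteq> {..n}" "length xs \<le> n"
      using xs by auto
    then show ?thesis
      using xs by blast
  qed
  then have "distinct_partitions n \<subseteq> mset ` {xs. set xs \<subseteq> {..n} \<and> length xs \<le> n}"
    by blast
  then show ?thesis
    by (rule finite_subset) (simp add: finite_lists_length_le)
qed

end

theory Submission
  imports Defs "HOL-Computational_Algebra.Formal_Power_Series"
begin

text \<open>
  Let \<open>E(m, n)\<close> be the number of partitions of \<open>n\<close> into distinct parts one of which is \<open>m\<close>. For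
  \<open>n > 8\<close> the sequence \<open>E(m, n)\<close> is decreasing in \<open>m \<ge> 1\<close>; as \<open>D\<^sub>r\<^sub>,\<^sub>t(n)\<close> is the sum of \<open>E(k, n)\<close> over
  \<open>k \<equiv> r (mod t)\<close>, shifting \<open>k\<close> by \<open>s - r\<close> gives the inequality for all \<open>t\<close> and all \<open>n > 8\<close>.

  The difference \<open>E(m, n) - E(m + 1, n)\<close> is the coefficient of \<open>X\<close> to the power \<open>n - m\<close> in
  \<open>(1 - X) \<Prod> (1 + X\<^sup>i)\<close>, the product running over all \<open>i\<close> except \<open>m\<close> and \<open>m + 1\<close>. Let \<open>p\<close> be the odd and
  \<open>q\<close> the even one of these two numbers. By Euler's theorem on odd and distinct parts the series is
  \<open>(1 - X\<^sup>q) / ((1 - X\<^sup>2\<^sup>q) (1 - X\<^sup>2\<^sup>p))\<close> divided by the product of \<open>1 - X\<^sup>j\<close> over the odd \<open>j \<ge> 3\<close> other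
  than \<open>p\<close>. If \<open>m \<ge> 5\<close>, then \<open>q = 3 + (q - 3)\<close> is a sum of two such \<open>j\<close>, which makes all
  coefficients nonnegative. For \<open>m \<le> 4\<close> the finitely many factors with \<open>i < m\<close> are multiplied out,
  and the remaining partitions into parts \<open>\<ge> m + 2\<close> increase in number because one can add \<open>1\<close>
  to the largest part.
\<close>

unbundle fps_syntax

section \<open>Generating functions for sets of distinct parts, and Euler's identity\<close>

definition distinct_gf :: "nat set \<Rightarrow> rat fps" where
  "distinct_gf S = (\<Prod>i\<in>S. 1 + fps_X ^ i)"

lemma distinct_gf_insert:
  assumes "finite S" "m \<notin> S"
  shows "distinct_gf (insert m S) = (1 + fps_X ^ m) * distinct_gf S"
  using assms by (simp add: distinct_gf_def)

text \<open>Expanding the product takes \<open>1\<close> or the monomial from each factor, so the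
  terms correspond to the subsets of \<open>S\<close>.\<close>

lemma distinct_gf_nth:
  assumes "finite S"
  shows "distinct_gf S $ n = of_nat (card {A. A \<subseteq> S \<and> \<Sum>A = n})"
proof -
  have "distinct_gf S = (\<Sum>A\<in>Pow S. fps_X ^ \<Sum>A)"
    using assms prod_add[of S "\<lambda>i. fps_X ^ i :: rat fps" "\<lambda>_. 1"]
    by (simp add: distinct_gf_def add.commute power_sum)
  then have "distinct_gf S $ n = (\<Sum>A\<in>Pow S. if n = \<Sum>A then 1 else 0)"
    by (simp add: fps_sum_nth)
  also have "\<dots> = of_nat (card {A \<in> Pow S. n = \<Sum>A})"
    using assms by (simp add: sum.If_cases Int_def)
  also have "{A \<in> Pow S. n = \<Sum>A} = {A. A \<subseteq> S \<and> \<Sum>A = n}"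
    by auto
  finally show ?thesis .
qed

text \<open>The right-hand side is \<open>1\<close> up to terms of degree greater than \<open>L\<close>.\<close>

lemma euler_odd_distinct:
  "(\<Prod>i=1..L. 1 + fps_X ^ i) * (\<Prod>i=1..L. 1 - fps_X ^ (2 * i - 1)) =
   (\<Prod>j=Suc L..2 * L. 1 - (fps_X :: rat fps) ^ j)"
proof (induction L)
  case (Suc L)
  let ?f = "\<lambda>j. 1 - (fps_X :: rat fps) ^ j"
  \<comment> \<open>From \<open>L\<close> to \<open>Suc L\<close> the product on the right loses the
    exponent \<open>L + 1\<close> and gains \<open>2 * L + 1\<close> and \<open>2 * L + 2\<close>.
    The new odd factor supplies the former gain; \<open>1 + X^(L+1)\<close> turns the lost factor
    into the latter.\<close>
  have sq: "(1 + fps_X ^ Suc L) * ?f (Suc L) = ?f (2 * Suc L)"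
    by (simp add: algebra_simps mult_2 flip: power_add)
  have split: "prod ?f {Suc L..2 * Suc L} = ?f (Suc L) * prod ?f {Suc (Suc L)..2 * Suc L}"
    by (rule prod.atLeast_Suc_atMost) simp
  have "prod ?f {Suc L..2 * L} * ?f (2 * Suc L - 1) * ?f (2 * Suc L) = prod ?f {Suc L..2 * Suc L}"
    by simp
  then have "?f (Suc L) * ((\<Prod>i=1..Suc L. 1 + fps_X ^ i) * (\<Prod>i=1..Suc L. ?f (2 * i - 1)))
      = ?f (Suc L) * prod ?f {Suc (Suc L)..2 * Suc L}"
    unfolding split[symmetric] Suc.IH[symmetric] sq[symmetric]
    by (simp add: mult_ac)
  moreover have "?f (Suc L) \<noteq> 0"
  proof
    assume "?f (Suc L) = 0"
    then have "?f (Suc L) $ 0 = 0" by simp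
    then show False by simp
  qed
  ultimately show ?case
    by (simp only: mult_cancel_left) simp
qed simp

section \<open>Power series with nonnegative coefficients\<close>

definition nonneg_fps :: "rat fps \<Rightarrow> bool" where
  "nonneg_fps f \<longleftrightarrow> (\<forall>n. 0 \<le> f $ n)"

lemma nonneg_fps_mult: "nonneg_fps f \<Longrightarrow> nonneg_fps g \<Longrightarrow> nonneg_fps (f * g)"
  by (auto simp: nonneg_fps_def fps_mult_nth intro!: sum_nonneg)

lemma nonneg_fps_add: "nonneg_fps f \<Longrightarrow> nonneg_fps g \<Longrightarrow> nonneg_fps (f + g)"
  by (auto simp: nonneg_fps_def)

lemma nonneg_fps_one: "nonneg_fps 1"
  by (auto simp: nonneg_fps_def)

lemma nonneg_fps_X_power: "nonneg_fps (fps_X ^ k)"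
  by (auto simp: nonneg_fps_def)

lemma nonneg_fps_prod: "(\<And>i. i \<in> S \<Longrightarrow> nonneg_fps (f i)) \<Longrightarrow> nonneg_fps (\<Prod>i\<in>S. f i)"
  by (induction S rule: infinite_finite_induct) (auto intro: nonneg_fps_mult nonneg_fps_one)

lemma one_minus_X_power_inverse:
  assumes "0 < k"
  shows "(1 - fps_X ^ k) * inverse (1 - fps_X ^ k) = (1 :: rat fps)"
  by (rule inverse_mult_eq_1') (use assms in simp)

lemma nonneg_fps_inverse:
  assumes "0 < k"
  shows "nonneg_fps (inverse (1 - fps_X ^ k))"
proof -
  define g :: "rat fps" where "g = Abs_fps (\<lambda>n. if k dvd n then 1 else 0)"
  have "(1 - fps_X ^ k) * g = 1"
    using assms
    by (auto simp: fps_eq_iff g_def algebra_simps fps_X_power_mult_nth dvd_minus_self dest: dvd_imp_le)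
  then have "inverse (1 - fps_X ^ k) = g"
    by (rule fps_inverse_unique)
  then show ?thesis by (simp add: nonneg_fps_def g_def)
qed

lemma one_minus_X_power_mult_nth:
  assumes "n < j"
  shows "((1 - fps_X ^ j) * f) $ n = (f :: rat fps) $ n"
  using assms by (simp add: left_diff_distrib fps_X_power_mult_nth)

text \<open>Serves to discard the right-hand side of the truncated Euler identity in low
  degrees.\<close>

lemma prod_one_minus_X_power_mult_nth:
  assumes "finite S" "\<And>j. j \<in> S \<Longrightarrow> n < j"
  shows "((\<Prod>j\<in>S. 1 - fps_X ^ j) * f) $ n = (f :: rat fps) $ n"
  using assms
  by (induction S rule: finite_induct) (simp_all add: mult.assoc one_minus_X_power_mult_nth)

text \<open>Since \<open>1 - X^(a+b) = (1 - X^a) + X^a * (1 - X^b)\<close>, each summand cancels one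
  of the two denominators.\<close>

lemma nonneg_fps_one_minus_X_power_sum:
  assumes "0 < a" "0 < b"
  shows "nonneg_fps ((1 - fps_X ^ (a + b)) * (inverse (1 - fps_X ^ a) * inverse (1 - fps_X ^ b)))"
proof -
  let ?u = "1 - fps_X ^ a :: rat fps" and ?v = "1 - fps_X ^ b :: rat fps"
  have "1 - fps_X ^ (a + b) = ?u + fps_X ^ a * ?v"
    by (simp add: algebra_simps power_add)
  moreover have "(u + x * v) * (u' * v') = (u * u') * v' + x * u' * (v * v')"
    for u u' v v' x :: "rat fps"
    by (simp add: algebra_simps)
  ultimately have "(1 - fps_X ^ (a + b)) * (inverse ?u * inverse ?v) =
      (?u * inverse ?u) * inverse ?v + fps_X ^ a * inverse ?u * (?v * inverse ?v)"
    by metis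
  also have "\<dots> = inverse ?v + fps_X ^ a * inverse ?u"
    using assms by (simp add: one_minus_X_power_inverse)
  finally show ?thesis
    using assms by (simp add: nonneg_fps_add nonneg_fps_mult nonneg_fps_X_power nonneg_fps_inverse)
qed

section \<open>Monotonicity for distinct parts bounded below\<close>

text \<open>Raising the largest element by 1 is injective. \<open>0 < N\<close> provides a largest
  element, and \<open>N < L\<close> keeps the raised one within \<open>{k..L}\<close>.\<close>

lemma card_distinct_sum_le_Suc:
  fixes k L N :: nat
  assumes "0 < N" "N < L"
  shows "card {A. A \<subseteq> {k..L} \<and> \<Sum>A = N} \<le> card {A. A \<subseteq> {k..L} \<and> \<Sum>A = Suc N}"
proof (rule card_inj_on_le)
  let ?f = "\<lambda>A :: nat set. insert (Suc (Max A)) (A - {Max A})"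
  have fin: "finite A" "A \<noteq> {}" if "A \<subseteq> {k..L}" "\<Sum>A = N" for A
    using that assms finite_subset by auto
  have notin: "Suc (Max A) \<notin> A" if "finite A" for A :: "nat set"
    using Max_ge[OF that, of "Suc (Max A)"] by linarith
  have Max: "Max (?f A) = Suc (Max A)" if "finite A" for A :: "nat set"
    using that by (intro Max_eqI) (auto intro: le_SucI)
  show "inj_on ?f {A. A \<subseteq> {k..L} \<and> \<Sum>A = N}"
  proof (rule inj_on_inverseI)
    fix A assume "A \<in> {A. A \<subseteq> {k..L} \<and> \<Sum>A = N}"
    then have A: "finite A" "A \<noteq> {}" using fin by auto
    show "(\<lambda>B. insert (Max B - 1) (B - {Max B})) (?f A) = A"
      unfolding Max[OF A(1)] using notin[OF A(1)] Max_in[OF A] by auto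
  qed
  show "?f ` {A. A \<subseteq> {k..L} \<and> \<Sum>A = N} \<subseteq> {A. A \<subseteq> {k..L} \<and> \<Sum>A = Suc N}"
  proof clarify
    fix A assume A: "A \<subseteq> {k..L}" "N = \<Sum>A"
    then have fA: "finite A" "A \<noteq> {}" using fin[OF A(1) A(2)[symmetric]] by simp_all
    have sum: "\<Sum>A = Max A + \<Sum>(A - {Max A})"
      by (rule sum.remove[OF fA(1) Max_in[OF fA]])
    moreover have "\<Sum>(?f A) = Suc (Max A) + \<Sum>(A - {Max A})"
      by (rule sum.insert) (use fA(1) notin[OF fA(1)] in simp_all)
    ultimately have "\<Sum>(?f A) = Suc (\<Sum>A)"
      by linarith
    moreover have "?f A \<subseteq> {k..L}"
    proof
      fix x assume "x \<in> ?f A"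
      then consider "x = Suc (Max A)" | "x \<in> A" by blast
      then show "x \<in> {k..L}"
      proof cases
        case 1
        have "k \<le> Max A" using A(1) Max_in[OF fA] by auto
        then show ?thesis using 1 sum A(2) assms(2) by simp
      qed (use A(1) in blast)
    qed
    ultimately show "?f A \<subseteq> {k..L} \<and> \<Sum>(?f A) = Suc (\<Sum>A)"
      by blast
  qed
qed (rule finite_subset[of _ "Pow {k..L}"], auto)

text \<open>Degree 0 is excluded: it counts the empty set, which has no largest element, and for
  \<open>k >= 2\<close> the coefficient may drop from 1 to 0 in degree 1.\<close>

lemma distinct_gf_atLeast_mono:
  assumes "0 < M" "M \<le> N" "N \<le> L"
  shows "distinct_gf {k..L} $ M \<le> distinct_gf {k..L} $ N"
  using assms(2,1,3)
proof (induction N rule: dec_induct)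
  case (step N)
  then have "card {A. A \<subseteq> {k..L} \<and> \<Sum>A = N} \<le> card {A. A \<subseteq> {k..L} \<and> \<Sum>A = Suc N}"
    by (intro card_distinct_sum_le_Suc) auto
  then have "distinct_gf {k..L} $ N \<le> distinct_gf {k..L} $ Suc N"
    by (simp add: distinct_gf_nth)
  with step show ?case
    by linarith
qed simp


section \<open>Sign of the coefficients for adjacent parts\<close>

text \<open>The two adjacent parts are named by parity, not by size, so that one argument covers
  both orders.\<close>

lemma distinct_gf_coeff_diff_nonneg_large:
  assumes "odd p" "even q" "q = Suc p \<or> p = Suc q" "6 \<le> q" "p \<le> L" "q \<le> L" "k \<le> L"
  shows "0 \<le> ((1 - fps_X) * distinct_gf ({1..L} - {p, q})) $ k"
proof -
  define G where "G = (1 - fps_X) * distinct_gf ({1..L} - {p, q})"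
  define u :: "nat \<Rightarrow> rat fps" where "u j = 1 - fps_X ^ j" for j
  define odds where "odds = (\<lambda>i. 2 * i - 1) ` {1..L}"
  define W where "W = odds - {1, p}"
  define V where "V = (\<Prod>j\<in>W. inverse (u j))"
  define R where "R = (\<Prod>j=Suc L..2 * L. u j)"
  \<comment> \<open>\<open>Y\<close> is the quotient for which \<open>G = R * Y\<close>. The factor
    \<open>1 + X^p\<close> pairs with the odd factor \<open>u p\<close> to give
    \<open>u (2 * p)\<close>, whereas \<open>1 + X^q\<close> has no such partner and leaves
    \<open>u q\<close> in the numerator. As \<open>R\<close> is 1 up to degree \<open>L\<close>, the
    coefficients of \<open>G\<close> and \<open>Y\<close> agree there.\<close>
  define Y where "Y = inverse (u (2 * p)) * (inverse (u (2 * q)) * (u q * V))"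
  have fin: "finite W" by (simp add: W_def odds_def)
  have p5: "5 \<le> p" using assms by presburger
  have odds: "j \<in> odds" if "odd j" "j \<le> L" for j
  proof -
    from that obtain i where "j = 2 * i + 1" by (auto elim: oddE)
    then show ?thesis
      using that by (auto simp: odds_def intro!: image_eqI[of _ _ "Suc i"])
  qed
  have W_pos: "0 < j" if "j \<in> W" for j
    using that by (auto simp: W_def odds_def)
  have uu: "u j * inverse (u j) = 1" if "0 < j" for j
    using one_minus_X_power_inverse[OF that] by (simp add: u_def)
  have u_double: "(1 + fps_X ^ j) * u j = u (2 * j)" for j
    by (simp add: u_def algebra_simps mult_2 flip: power_add)
  have uV: "(\<Prod>j\<in>W. u j) * V = 1"
    unfolding V_def prod.distrib[symmetric] using W_pos uu by simp

  have gf: "distinct_gf {1..L} = (1 + fps_X ^ p) * ((1 + fps_X ^ q) * distinct_gf ({1..L} - {p, q}))"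
  proof -
    have "{1..L} = insert p (insert q ({1..L} - {p, q}))"
      using assms p5 by auto
    moreover have "p \<noteq> q" using assms by auto
    ultimately show ?thesis
      by (metis (no_types, lifting) Diff_iff distinct_gf_insert finite.insertI finite_Diff
          finite_atLeastAtMost insertE insertI1 insertI2)
  qed
  have inj: "inj_on (\<lambda>i. 2 * i - 1) {1..L}"
    by (auto simp: inj_on_def)
  have "R = distinct_gf {1..L} * (\<Prod>j\<in>odds. u j)"
    unfolding R_def odds_def prod.reindex[OF inj] u_def distinct_gf_def o_def
    by (rule euler_odd_distinct[symmetric])
  also have "(\<Prod>j\<in>odds. u j) = u 1 * (u p * (\<Prod>j\<in>W. u j))"
  proof -
    have "odds = insert 1 (insert p W)" "1 \<notin> insert p W" "p \<notin> W"
      using odds[of 1] odds[of p] assms p5 by (auto simp: W_def)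
    then show ?thesis
      using fin by simp
  qed
  finally have R: "R = G * u (2 * p) * (1 + fps_X ^ q) * (\<Prod>j\<in>W. u j)"
    unfolding gf G_def u_double[of p, symmetric] by (simp add: u_def mult_ac)
  have "R * Y = G * (u (2 * p) * inverse (u (2 * p))) *
      ((1 + fps_X ^ q) * u q * inverse (u (2 * q))) * ((\<Prod>j\<in>W. u j) * V)"
    unfolding R Y_def by (simp only: mult_ac)
  then have "R * Y = G"
    using assms p5 by (simp add: u_double uu uV)
  moreover have "(R * Y) $ k = Y $ k"
    unfolding R_def u_def using assms by (intro prod_one_minus_X_power_mult_nth) auto
  moreover have "nonneg_fps Y"
  proof -
    have inv: "nonneg_fps (inverse (u j))" if "0 < j" for j
      unfolding u_def using that by (rule nonneg_fps_inverse)
    \<comment> \<open>For \<open>q = 6\<close> the summands 3 and \<open>q - 3\<close> coincide, but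
      \<open>W\<close> offers 3 only once; there \<open>u 6 = (1 + X^3) * u 3\<close> is used
      instead.\<close>
    have "nonneg_fps (u q * V)"
    proof (cases "q = 6")
      case True
      have "3 \<in> W" using odds[of 3] assms p5 by (auto simp: W_def)
      then have "V = inverse (u 3) * (\<Prod>j\<in>W - {3}. inverse (u j))"
        unfolding V_def using fin by (rule prod.remove[rotated])
      then have "u q * V = ((1 + fps_X ^ 3) * (u 3 * inverse (u 3))) * (\<Prod>j\<in>W - {3}. inverse (u j))"
        using u_double[of 3] True by (simp add: mult.assoc[symmetric])
      then show ?thesis
        using uu[of 3] inv W_pos
        by (auto intro!: nonneg_fps_mult nonneg_fps_add nonneg_fps_one nonneg_fps_X_power nonneg_fps_prod)
    next
      case False
      then have q8: "8 \<le> q" using assms by presburger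
      \<comment> \<open>\<open>q - 3\<close> is odd and at least 5, and it is not \<open>p\<close>
        because \<open>p\<close> and \<open>q\<close> differ by 1.\<close>
      have "3 \<in> W" "q - 3 \<in> W - {3}"
        using odds[of 3] odds[of "q - 3"] assms p5 q8 by (auto simp: W_def)
      then have V: "V = inverse (u 3) * (inverse (u (q - 3)) * (\<Prod>j\<in>W - {3} - {q - 3}. inverse (u j)))"
        unfolding V_def using fin by (metis finite_Diff prod.remove)
      have "nonneg_fps (u q * (inverse (u 3) * inverse (u (q - 3))))"
        using nonneg_fps_one_minus_X_power_sum[of 3 "q - 3"] q8 by (simp add: u_def)
      then have "nonneg_fps (u q * (inverse (u 3) * inverse (u (q - 3)))
          * (\<Prod>j\<in>W - {3} - {q - 3}. inverse (u j)))"
        using inv W_pos by (auto intro!: nonneg_fps_mult nonneg_fps_prod)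
      then show ?thesis
        unfolding V by (simp only: mult_ac)
    qed
    then show ?thesis
      unfolding Y_def using assms(4) p5 inv by (intro nonneg_fps_mult[OF _ nonneg_fps_mult]) auto
  qed
  ultimately show ?thesis
    by (simp add: nonneg_fps_def G_def)
qed

text \<open>For \<open>m\<close> = 1, 2, 3, 4 the factors below \<open>m\<close> times
  \<open>1 - X\<close> give \<open>1 - X\<close>, \<open>1 - X^2\<close>, \<open>1 - X^4\<close> and
  \<open>(1 - X^4) * (1 + X^3)\<close>. The threshold 9 is sharp: for \<open>m = 4\<close>,
  \<open>N = 4\<close> the coefficient is -1.\<close>

lemma distinct_gf_coeff_diff_nonneg_small:
  assumes "1 \<le> m" "m \<le> 4" "9 \<le> N + m" "N \<le> L"
  shows "0 \<le> ((1 - fps_X) * distinct_gf ({1..L} - {m, Suc m})) $ N"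
proof -
  define g where "g = distinct_gf {m + 2..L}"
  have mono: "g $ i \<le> g $ j" if "0 < i" "i \<le> j" "j \<le> L" for i j
    unfolding g_def using that by (rule distinct_gf_atLeast_mono)
  have "{1..L} - {m, Suc m} = {1..<m} \<union> {m + 2..L}"
    using assms by auto
  moreover have "distinct_gf ({1..<m} \<union> {m + 2..L}) = distinct_gf {1..<m} * g"
    unfolding g_def distinct_gf_def by (rule prod.union_disjoint) auto
  ultimately have gf: "distinct_gf ({1..L} - {m, Suc m}) = distinct_gf {1..<m} * g"
    by (simp only:)
  consider "m = 1" | "m = 2" | "m = 3" | "m = 4" using assms by linarith
  then show ?thesis
  proof cases
    case 1
    then have "(1 - fps_X) * distinct_gf ({1..L} - {m, Suc m}) = g - fps_X ^ 1 * g"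
      unfolding gf by (simp add: distinct_gf_def algebra_simps)
    then show ?thesis
      using assms 1 mono[of "N - 1" N] by (simp add: fps_X_power_mult_nth del: power_one_right)
  next
    case 2
    then have "{1..<m} = {1}" by auto
    then have "(1 - fps_X) * distinct_gf ({1..L} - {m, Suc m}) = g - fps_X ^ 2 * g"
      unfolding gf by (simp add: distinct_gf_def algebra_simps power2_eq_square)
    then show ?thesis
      using assms 2 mono[of "N - 2" N] by (simp add: fps_X_power_mult_nth)
  next
    case 3
    then have "{1..<m} = {1, 2}" by auto
    then have "(1 - fps_X) * distinct_gf ({1..L} - {m, Suc m}) = g - fps_X ^ 4 * g"
      unfolding gf by (simp add: distinct_gf_def algebra_simps eval_nat_numeral)
    then show ?thesis
      using assms 3 mono[of "N - 4" N] by (simp add: fps_X_power_mult_nth)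
  next
    case 4
    then have "{1..<m} = {1, 2, 3}" by auto
    then have eq: "(1 - fps_X) * distinct_gf ({1..L} - {m, Suc m})
        = g + fps_X ^ 3 * g - fps_X ^ 4 * g - fps_X ^ 7 * g"
      unfolding gf by (simp add: distinct_gf_def algebra_simps eval_nat_numeral)
    \<comment> \<open>For \<open>N = 7\<close> the term \<open>X^7 * g\<close> involves degree 0,
      outside the range of \<open>mono\<close>. The set \<open>{7}\<close> makes up for the empty
      set, as 7 is an allowed part.\<close>
    have "g $ 0 \<le> g $ 7" if "7 \<le> L"
    proof -
      let ?S = "\<lambda>n. {A. A \<subseteq> {m + 2..L} \<and> \<Sum>A = n}"
      have "A = {}" if "A \<in> ?S 0" for A
      proof -
        from that have "finite A" using finite_subset by auto
        with that show "A = {}" by auto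
      qed
      then have "inj_on (\<lambda>_. {7 :: nat}) (?S 0)"
        unfolding inj_on_def by blast
      moreover have "(\<lambda>_. {7}) ` ?S 0 \<subseteq> ?S 7"
        using 4 \<open>7 \<le> L\<close> by auto
      moreover have "finite (?S 7)"
        by (rule finite_subset[of _ "Pow {m + 2..L}"]) auto
      ultimately have "card (?S 0) \<le> card (?S 7)"
        by (rule card_inj_on_le)
      then show ?thesis by (simp add: g_def distinct_gf_nth)
    qed
    moreover have "0 \<le> g $ j" for j
      by (simp add: g_def distinct_gf_nth)
    ultimately have "(if N < 7 then 0 else g $ (N - 7)) \<le> g $ N"
      using assms mono[of "N - 7" N] by (cases "N = 7") auto
    moreover have "g $ (N - 4) \<le> g $ (N - 3)"
      using assms 4 by (intro mono) auto
    ultimately show ?thesis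
      unfolding eq using assms 4 by (simp add: fps_X_power_mult_nth split: if_splits)
  qed
qed

section \<open>Partitions into distinct parts that contain a given part\<close>

lemma count_distinct_partitions:
  assumes "p \<in> distinct_partitions n"
  shows "count p k = (if k \<in># p then 1 else 0)"
proof -
  have "count p k \<le> 1" using assms by (simp add: distinct_partitions_def)
  then show ?thesis
    by (auto simp: count_eq_zero_iff intro: le_antisym)
qed

definition num_containing :: "nat \<Rightarrow> nat \<Rightarrow> nat" where
  "num_containing m n = card {p \<in> distinct_partitions n. m \<in># p}"

text \<open>A multiset without repetitions is determined by its support, and \<open>n <= L\<close>
  ensures that every part lies in \<open>{1..L}\<close>.\<close>

lemma num_containing_eq_card_sets:
  assumes "n \<le> L"
  shows "num_containing m n = card {A. A \<subseteq> {1..L} \<and> \<Sum>A = n \<and> m \<in> A}"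
proof -
  have "bij_betw mset_set {A. A \<subseteq> {1..L} \<and> \<Sum>A = n \<and> m \<in> A} {p \<in> distinct_partitions n. m \<in># p}"
  proof (rule bij_betwI[where g = set_mset])
    show "mset_set \<in> {A. A \<subseteq> {1..L} \<and> \<Sum>A = n \<and> m \<in> A} \<rightarrow> {p \<in> distinct_partitions n. m \<in># p}"
    proof (rule funcsetI)
      fix A assume A: "A \<in> {A. A \<subseteq> {1..L} \<and> \<Sum>A = n \<and> m \<in> A}"
      then have "finite A" using finite_subset by auto
      with A show "mset_set A \<in> {p \<in> distinct_partitions n. m \<in># p}"
        by (auto simp: distinct_partitions_def is_partition_def count_mset_set' sum_unfold_sum_mset)
    qed
    have id: "mset_set (set_mset p) = p" if "p \<in> distinct_partitions n" for p
      by (rule multiset_eqI) (simp add: count_distinct_partitions[OF that] count_mset_set')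
    then show "\<And>p. p \<in> {p \<in> distinct_partitions n. m \<in># p} \<Longrightarrow> mset_set (set_mset p) = p"
      by simp
    show "set_mset \<in> {p \<in> distinct_partitions n. m \<in># p} \<rightarrow> {A. A \<subseteq> {1..L} \<and> \<Sum>A = n \<and> m \<in> A}"
    proof (rule funcsetI)
      fix p assume p: "p \<in> {p \<in> distinct_partitions n. m \<in># p}"
      have "\<Sum>(set_mset p) = n"
        using p id[of p] by (simp add: sum_unfold_sum_mset distinct_partitions_def is_partition_def)
      moreover have "k \<le> \<Sum>(set_mset p)" if "k \<in># p" for k
        using that by (intro member_le_sum) auto
      ultimately show "set_mset p \<in> {A. A \<subseteq> {1..L} \<and> \<Sum>A = n \<and> m \<in> A}"
        using p assms by (fastforce simp: distinct_partitions_def is_partition_def Suc_le_eq)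
    qed
    show "\<And>A. A \<in> {A. A \<subseteq> {1..L} \<and> \<Sum>A = n \<and> m \<in> A} \<Longrightarrow> set_mset (mset_set A) = A"
      by (auto simp: finite_subset)
  qed
  then show ?thesis
    unfolding num_containing_def by (simp add: bij_betw_same_card)
qed

text \<open>Sets containing \<open>m\<close> are all sets minus those avoiding \<open>m\<close>, and
  \<open>(1 + X^m) * H - H = X^m * H\<close>.\<close>

lemma num_containing_eq_coeff:
  assumes "m \<in> {1..L}" "n \<le> L"
  shows "of_nat (num_containing m n) = (fps_X ^ m * distinct_gf ({1..L} - {m})) $ n"
proof -
  let ?all = "{A. A \<subseteq> {1..L} \<and> \<Sum>A = n}" and ?without = "{A. A \<subseteq> {1..L} - {m} \<and> \<Sum>A = n}"
  have fin: "finite ?all"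
    by (rule finite_subset[of _ "Pow {1..L}"]) auto
  have "{A. A \<subseteq> {1..L} \<and> \<Sum>A = n \<and> m \<in> A} = ?all - ?without"
    by auto
  moreover have "?without \<subseteq> ?all"
    by auto
  ultimately have "num_containing m n = card ?all - card ?without" "card ?without \<le> card ?all"
    using fin by (simp_all add: num_containing_eq_card_sets[OF assms(2)] card_Diff_subset
        finite_subset card_mono)
  then have "of_nat (num_containing m n) = (distinct_gf {1..L} - distinct_gf ({1..L} - {m})) $ n"
    by (simp add: distinct_gf_nth of_nat_diff)
  also have "distinct_gf {1..L} = (1 + fps_X ^ m) * distinct_gf ({1..L} - {m})"
    using distinct_gf_insert[of "{1..L} - {m}" m] assms by (simp add: insert_absorb)
  finally show ?thesis
    by (simp add: algebra_simps)
qed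

lemma num_containing_Suc_le:
  assumes "1 \<le> m" "8 < n"
  shows "num_containing (Suc m) n \<le> num_containing m n"
proof (cases "Suc m \<le> n")
  case True
  define T where "T = {1..n} - {m, Suc m}"
  have T: "{1..n} - {m} = insert (Suc m) T" "{1..n} - {Suc m} = insert m T"
    using assms True by (auto simp: T_def)
  have "of_nat (num_containing m n) - of_nat (num_containing (Suc m) n) =
      (fps_X ^ m * distinct_gf (insert (Suc m) T) - fps_X ^ Suc m * distinct_gf (insert m T)) $ n"
    using assms True num_containing_eq_coeff[of m n n] num_containing_eq_coeff[of "Suc m" n n]
    by (simp flip: T)
  \<comment> \<open>The mixed terms cancel:
    \<open>(1 + X^(m+1)) - X * (1 + X^m) = 1 - X\<close>.\<close>
  also have "fps_X ^ m * distinct_gf (insert (Suc m) T) - fps_X ^ Suc m * distinct_gf (insert m T)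
      = fps_X ^ m * ((1 - fps_X) * distinct_gf T)"
    by (simp add: distinct_gf_insert T_def algebra_simps)
  also have "\<dots> $ n = ((1 - fps_X) * distinct_gf T) $ (n - m)"
    using True by (simp add: fps_X_power_mult_nth)
  also have "\<dots> \<ge> 0"
  proof (cases "m \<le> 4")
    case le: True
    then show ?thesis
      unfolding T_def using assms by (intro distinct_gf_coeff_diff_nonneg_small) auto
  next
    case False
    show ?thesis
    proof (cases "odd m")
      case odd: True
      then have "6 \<le> Suc m" using False by presburger
      then show ?thesis
        unfolding T_def using odd True by (intro distinct_gf_coeff_diff_nonneg_large) auto
    next
      case even: False
      then have "6 \<le> m" using False by presburger
      then show ?thesis
        unfolding T_def using even True distinct_gf_coeff_diff_nonneg_large[of "Suc m" m n "n - m"]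
        by (simp add: insert_commute)
    qed
  qed
  finally show ?thesis
    by simp
next
  case False
  have "{A. A \<subseteq> {1..n} \<and> \<Sum>A = n \<and> Suc m \<in> A} = {}"
    using False by auto
  then show ?thesis
    by (simp only: num_containing_eq_card_sets[of n n "Suc m", OF order_refl] card.empty le0)
qed

lemma num_containing_antimono:
  assumes "1 \<le> m" "m \<le> m'" "8 < n"
  shows "num_containing m' n \<le> num_containing m n"
  using assms(2)
proof (induction m' rule: dec_induct)
  case (step k)
  then show ?case
    using num_containing_Suc_le[of k n] assms by simp
qed simp

section \<open>Summation over residue classes\<close>

text \<open>Double counting of pairs of a partition and one of its parts; distinctness makes each
  part count once.\<close>

lemma D_eq_sum_num_containing:
  "D r t n = (\<Sum>k | k \<in> {1..n} \<and> [k = r] (mod t). num_containing k n)"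
proof -
  have "size {#k \<in># p. [k = r] (mod t)#} =
      (\<Sum>k | k \<in> {1..n} \<and> [k = r] (mod t). if k \<in># p then 1 else 0)"
    if p: "p \<in> distinct_partitions n" for p
  proof -
    have part_le: "k \<le> n" if "k \<in># p" for k
      using p multi_member_split[OF that] by (auto simp: distinct_partitions_def is_partition_def)
    have "size {#k \<in># p. [k = r] (mod t)#} = (\<Sum>k | k \<in># p \<and> [k = r] (mod t). 1)"
      by (simp add: size_multiset_overloaded_eq count_distinct_partitions[OF p])
    also have "\<dots> = (\<Sum>k | k \<in> {1..n} \<and> [k = r] (mod t). if k \<in># p then 1 else 0)"
      using p part_le by (intro sum.mono_neutral_cong_left)
        (auto simp: distinct_partitions_def is_partition_def Suc_le_eq)
    finally show ?thesis .
  qed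
  then have "D r t n = (\<Sum>p\<in>distinct_partitions n.
      \<Sum>k | k \<in> {1..n} \<and> [k = r] (mod t). if k \<in># p then 1 else 0)"
    by (simp add: D_def)
  also have "\<dots> = (\<Sum>k | k \<in> {1..n} \<and> [k = r] (mod t).
      \<Sum>p\<in>distinct_partitions n. if k \<in># p then 1 else 0)"
    by (rule sum.swap)
  also have "\<dots> = (\<Sum>k | k \<in> {1..n} \<and> [k = r] (mod t). num_containing k n)"
    by (simp add: num_containing_def sum.If_cases finite_distinct_partitions Int_def)
  finally show ?thesis .
qed

lemma D_antimono:
  assumes "1 \<le> r" "r < s" "s \<le> t" "8 < n"
  shows "D s t n \<le> D r t n"
proof -
  let ?S = "{k. k \<in> {1..n} \<and> [k = s] (mod t)}" and ?R = "{k. k \<in> {1..n} \<and> [k = r] (mod t)}"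
  \<comment> \<open>Because \<open>1 <= s <= t\<close>, the least positive member of the class of
    \<open>s\<close> is \<open>s\<close> itself, also when \<open>s = t\<close> has residue 0. Hence
    \<open>k - (s - r)\<close> is an exact subtraction with value at least \<open>r\<close>.\<close>
  have ge: "s \<le> k" if "k \<in> ?S" for k
  proof (rule ccontr)
    assume "\<not> s \<le> k"
    with that assms have "k mod t = k" "k mod t = s mod t" "0 < k" by (auto simp: cong_def)
    with \<open>\<not> s \<le> k\<close> assms show False by (cases "s = t") auto
  qed
  have "D s t n \<le> (\<Sum>k\<in>?S. num_containing (k - (s - r)) n)"
    unfolding D_eq_sum_num_containing
  proof (rule sum_mono)
    fix k assume "k \<in> ?S"
    then show "num_containing k n \<le> num_containing (k - (s - r)) n"
      using ge[of k] assms by (intro num_containing_antimono) auto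
  qed
  also have "\<dots> = (\<Sum>k\<in>(\<lambda>k. k - (s - r)) ` ?S. num_containing k n)"
  proof (rule sum.reindex_cong[symmetric, OF _ refl refl])
    show "inj_on (\<lambda>k. k - (s - r)) ?S"
    proof (rule inj_onI)
      fix x y assume "x \<in> ?S" "y \<in> ?S" "x - (s - r) = y - (s - r)"
      then show "x = y" using ge[of x] ge[of y] by linarith
    qed
  qed
  also have "\<dots> \<le> D r t n"
    unfolding D_eq_sum_num_containing
  proof (rule sum_mono2)
    show "(\<lambda>k. k - (s - r)) ` ?S \<subseteq> ?R"
    proof clarify
      fix k assume k: "k \<in> {1..n}" "[k = s] (mod t)"
      then have "s \<le> k" using ge by simp
      then have "[(k - (s - r)) + (s - r) = r + (s - r)] (mod t)"
        using k assms by simp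
      then have "[k - (s - r) = r] (mod t)"
        by (simp only: cong_add_rcancel_nat)
      then show "k - (s - r) \<in> {1..n} \<and> [k - (s - r) = r] (mod t)"
        using k \<open>s \<le> k\<close> assms by auto
    qed
  qed auto
  finally show ?thesis .
qed

theorem corollary1p5:
  shows "(\<forall>r s t :: nat. 1 \<le> r \<and> r < s \<and> s \<le> t \<longrightarrow>
            (\<forall>\<^sub>F n in sequentially. D r t n \<ge> D s t n)) \<and>
         (\<forall>t :: nat. 2 \<le> t \<and> t \<le> 10 \<longrightarrow>
            (\<forall>r s :: nat. 1 \<le> r \<and> r < s \<and> s \<le> t \<longrightarrow>
               (\<forall>n > 8. D r t n \<ge> D s t n)))"
  by (blast intro: D_antimono eventually_mono[OF eventually_gt_at_top[of 8]])

end
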